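(* Let $\Sigma$ be an alphabet strictly totally ordered by $<_\Sigma$, and let $\mu$ be a non-binary, injective, and alphabetically ordered weight measure over $\Sigma$ with respect to a strictly totally ordered monoid $A$. The following statements are equivalent: 1. $\mu$ is gapfree. 2. $\mu$ has no gap over any word of the form $cacb$ where $a,b,c\in\Sigma$ and $a<_\Sigma b<_\Sigma c$. 3. $\mu$ is equivalent to the standard weight measure $\mu_\Sigma$.
   Context: An alphabet $\Sigma$ is a finite set; $\Sigma^*$ is the free monoid of finite words over $\Sigma$, $\varepsilon$ the empty word, $\Sigma^+=\Sigma^*\setminus\{\varepsilon\}$, $\Sigma^n$ the words of length $n$, $|w|$ the length of $w$. $[n]=\{1,\dots,n\}$, $[n]_0=\{0,\dots,n\}$. $\mathrm{Fact}_i(w)$ is the set of factors (contiguous subwords) of $w$ of length $i$. A strictly totally ordered monoid is a monoid $(A,\circ_A)$ with neutral element $1_A$ and a total order $<_A$ such that $a<_A b$ implies $a\circ_A c<_A b\circ_A c$ and $c\circ_A a<_A c\circ_A b$ for all $a,b,c\in A$. A weight measure over $\Sigma$ w.r.t. $A$ is a monoid morphism $\mu:\Sigma^*\to A$ such that $\mu(vw)=\mu(wv)$ and $\mu(w)<_A\mu(wv)$ for all $w\in\Sigma^*$, $v\in\Sigma^+$. For $w\in\Sigma^*$ define $f_{w,\mu}:[|w|]_0\to A$ by $f_{w,\mu}(i)=\max\{\mu(u)\mid u\in\mathrm{Fact}_i(w)\}$. $\mu$ is non-binary if $|\mu(\Sigma)|>2$ (where $\mu(\Sigma)$ is the set of weights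 of letters), injective if it is injective on $\Sigma$, and alphabetically ordered if $\mu(a)\le_A\mu(b)$ for all letters $a,b$ with $a\le_\Sigma b$. $\mu$ has a gap over $w\in\Sigma^*$ at index $i\in[|w|]$ if there is no $x\in\Sigma$ with $f_{w,\mu}(i)=f_{w,\mu}(i-1)\circ_A\mu(x)$; it has no gap over $w$ if it has no gap over $w$ at any index $i\in[|w|]$; it is gapfree if it has no gap over any word $w\in\Sigma^*$. Two weight measures $\mu_A,\mu_B$ over the same $\Sigma$ (w.r.t. monoids $A$, $B$) are equivalent if for all $n\in\mathbb{N}$ and all $v,w\in\Sigma^n$: $\mu_A(v)<_A\mu_A(w)$ iff $\mu_B(v)<_B\mu_B(w)$. For $\Sigma=\{a_1<_\Sigma a_2<_\Sigma\dots<_\Sigma a_n\}$ the standard weight measure $\mu_\Sigma$ is the weight measure w.r.t. $(\mathbb{N}_0,+)$ with the usual order given by $\mu_\Sigma(a_i)=i$ for all $i\in[n]$. *)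

theory Defs
  imports Main "HOL-Library.Sublist"
begin

text \<open>
  Monoids are written additively so that \<open>nat\<close> with its usual addition and order is
  an instance. \<open>monoid_add\<close> does not assume commutativity, hence the two monotonicity axioms.
\<close>

class strict_ordered_monoid_add = monoid_add + linorder +
  assumes add_strict_right_mono_ord: "a < b \<Longrightarrow> a + c < b + c"
    and add_strict_left_mono_ord: "a < b \<Longrightarrow> c + a < c + b"

instance nat :: strict_ordered_monoid_add
  by standard auto

definition weight_measure :: "('a::finite list \<Rightarrow> 'm::strict_ordered_monoid_add) \<Rightarrow> bool" where
  "weight_measure \<mu> \<longleftrightarrow>
     \<mu> [] = 0 \<and>
     (\<forall>v w. \<mu> (v @ w) = \<mu> v + \<mu> w) \<and>
     (\<forall>v w. \<mu> (v @ w) = \<mu> (w @ v)) \<and>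
     (\<forall>w v. v \<noteq> [] \<longrightarrow> \<mu> w < \<mu> (w @ v))"

definition Fact :: "nat \<Rightarrow> 'a list \<Rightarrow> 'a list set" where
  "Fact i w = {u. sublist u w \<and> length u = i}"

text \<open>Only meaningful for \<open>i \<le> length w\<close>; otherwise the set of factors is empty.\<close>

definition max_weight :: "('a list \<Rightarrow> 'm::linorder) \<Rightarrow> 'a list \<Rightarrow> nat \<Rightarrow> 'm" where
  "max_weight \<mu> w i = Max {\<mu> u | u. u \<in> Fact i w}"

definition non_binary :: "('a::finite list \<Rightarrow> 'm) \<Rightarrow> bool" where
  "non_binary \<mu> \<longleftrightarrow> card (range (\<lambda>x. \<mu> [x])) > 2"

definition injective_weight :: "('a list \<Rightarrow> 'm) \<Rightarrow> bool" where
  "injective_weight \<mu> \<longleftrightarrow> inj (\<lambda>x. \<mu> [x])"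

definition alphabetically_ordered :: "('a::linorder list \<Rightarrow> 'm::linorder) \<Rightarrow> bool" where
  "alphabetically_ordered \<mu> \<longleftrightarrow> (\<forall>a b. a \<le> b \<longrightarrow> \<mu> [a] \<le> \<mu> [b])"

definition has_gap_at ::
    "('a list \<Rightarrow> 'm::strict_ordered_monoid_add) \<Rightarrow> 'a list \<Rightarrow> nat \<Rightarrow> bool" where
  "has_gap_at \<mu> w i \<longleftrightarrow> \<not> (\<exists>x. max_weight \<mu> w i = max_weight \<mu> w (i - 1) + \<mu> [x])"

definition no_gap_over :: "('a list \<Rightarrow> 'm::strict_ordered_monoid_add) \<Rightarrow> 'a list \<Rightarrow> bool" where
  "no_gap_over \<mu> w \<longleftrightarrow> (\<forall>i\<in>{1..length w}. \<not> has_gap_at \<mu> w i)"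

definition gapfree :: "('a list \<Rightarrow> 'm::strict_ordered_monoid_add) \<Rightarrow> bool" where
  "gapfree \<mu> \<longleftrightarrow> (\<forall>w. no_gap_over \<mu> w)"

definition equivalent_weights ::
    "('a list \<Rightarrow> 'm::linorder) \<Rightarrow> ('a list \<Rightarrow> 'n::linorder) \<Rightarrow> bool" where
  "equivalent_weights \<mu> \<nu> \<longleftrightarrow>
     (\<forall>n v w. length v = n \<and> length w = n \<longrightarrow> (\<mu> v < \<mu> w \<longleftrightarrow> \<nu> v < \<nu> w))"

text \<open>If \<open>a\<close> is the \<open>i\<close>-th smallest letter (counted from 1), then \<open>card {..a} = i\<close>.\<close>

definition standard_weight :: "'a::{finite,linorder} list \<Rightarrow> nat" where
  "standard_weight w = (\<Sum>a\<leftarrow>w. card {..a})"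

lemma standard_weight_nth:
  fixes as :: "'a::{finite,linorder} list"
  assumes "sorted_wrt (<) as" "set as = UNIV" "i \<in> {1..length as}"
  shows "standard_weight [as ! (i - 1)] = i"
proof -
  have "{..as ! (i - 1)} = (!) as ` {..<i}"
  proof (intro set_eqI iffI)
    fix x assume x: "x \<in> {..as ! (i - 1)}"
    obtain j where j: "j < length as" "x = as ! j"
      using assms(2) by (metis UNIV_I in_set_conv_nth)
    have "j < i"
    proof (rule ccontr)
      assume "\<not> j < i"
      then have "as ! (i - 1) < as ! j"
        using assms j by (intro sorted_wrt_nth_less[of "(<)"]) auto
      then show False using x j by auto
    qed
    then show "x \<in> (!) as ` {..<i}" using j by auto
  next
    fix x assume "x \<in> (!) as ` {..<i}"
    then obtain j where j: "j < i" "x = as ! j" by auto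
    show "x \<in> {..as ! (i - 1)}"
    proof (cases "j = i - 1")
      case False
      then have "as ! j < as ! (i - 1)"
        using assms j by (intro sorted_wrt_nth_less[of "(<)"]) auto
      then show ?thesis using j by auto
    qed (use j in auto)
  qed
  moreover have "inj_on ((!) as) {..<i}"
    using assms strict_sorted_iff[of as] by (auto simp: inj_on_def nth_eq_iff_index_eq)
  ultimately show ?thesis
    by (simp add: standard_weight_def card_image)
qed

lemma weight_measure_standard_weight:
  "weight_measure (standard_weight :: 'a::{finite,linorder} list \<Rightarrow> nat)"
proof -
  have pos: "0 < card {..x}" for x :: 'a
    by (simp add: card_gt_0_iff)
  show ?thesis
    using pos by (auto simp: weight_measure_def standard_weight_def neq_Nil_conv)
qed

end

theory Submission
  imports Defs "HOL-Library.Multiset"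
begin

text \<open>
  On the word \<open>cacb\<close> only index 3 can carry a gap, and there is none iff
  \<open>\<mu>(a) + \<mu>(c) = \<mu>(b) + \<mu>(x)\<close> for some letter \<open>x\<close>. Monotonicity forces \<open>a < x < c\<close>, so for three
  consecutive letters \<open>x = b\<close>: the letter weights form an arithmetic progression. Since \<open>\<mu>\<close>
  depends only on the multiset of letters, the weight of a word is then determined, strictly
  monotonically, by its length and its standard weight.
  Conversely, for the standard weight the maxima at consecutive factor lengths differ by at least 1
  and at most the size of the alphabet, hence by the weight of a letter; equivalence transfers this
  to \<open>\<mu>\<close>.
\<close>

section \<open>Cancellation in ordered monoids; factors and their maximal weights\<close>

lemma add_right_less_cancel_ord:
  fixes a b c :: "'m::strict_ordered_monoid_add"
  shows "a + c < b + c \<longleftrightarrow> a < b"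
  by (metis add_strict_right_mono_ord less_asym neq_iff)

lemma add_right_cancel_ord:
  fixes a b c :: "'m::strict_ordered_monoid_add"
  shows "a + c = b + c \<longleftrightarrow> a = b"
  by (metis add_strict_right_mono_ord neq_iff)

lemma finite_Fact: "finite (Fact i w)"
proof -
  have "Fact i w \<subseteq> set (sublists w)"
    by (auto simp: Fact_def)
  then show ?thesis
    by (rule finite_subset) simp
qed

lemma Fact_nonempty:
  assumes "i \<le> length w"
  shows "Fact i w \<noteq> {}"
proof -
  have "take i w \<in> Fact i w"
    using assms by (auto simp: Fact_def)
  then show ?thesis by blast
qed

lemma max_weight_attained:
  assumes "i \<le> length w"
  obtains u where "u \<in> Fact i w" "max_weight \<mu> w i = \<mu> u" "\<And>v. v \<in> Fact i w \<Longrightarrow> \<mu> v \<le> \<mu> u"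
proof -
  have S: "{\<mu> u | u. u \<in> Fact i w} = \<mu> ` Fact i w" by auto
  have "max_weight \<mu> w i \<in> \<mu> ` Fact i w"
    unfolding max_weight_def S using assms by (intro Max_in) (auto simp: finite_Fact Fact_nonempty)
  moreover have "\<mu> v \<le> max_weight \<mu> w i" if "v \<in> Fact i w" for v
    unfolding max_weight_def S using that by (intro Max_ge) (auto simp: finite_Fact)
  ultimately show ?thesis using that by auto
qed

lemma max_weight_eqI:
  assumes "u \<in> Fact i w" "\<And>v. v \<in> Fact i w \<Longrightarrow> \<mu> v \<le> \<mu> u"
  shows "max_weight \<mu> w i = \<mu> u"
  unfolding max_weight_def using assms
  by (intro Max_eqI) (auto simp: finite_Fact)

text \<open>If no letter of \<open>w\<close> follows the chosen occurrence of \<open>u\<close>, then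
  \<open>u\<close> is a proper suffix and some letter precedes it.\<close>

lemma Fact_extend:
  assumes "u \<in> Fact i w" "i < length w"
  obtains x where "u @ [x] \<in> Fact (Suc i) w" | x where "x # u \<in> Fact (Suc i) w"
proof -
  obtain p s where w: "w = p @ u @ s" and len: "length u = i"
    using assms by (auto simp: Fact_def sublist_def)
  show ?thesis
  proof (cases s)
    case (Cons y s')
    then have "w = p @ (u @ [y]) @ s'" using w by simp
    then have "u @ [y] \<in> Fact (Suc i) w" using len by (auto simp: Fact_def sublist_def)
    then show ?thesis using that by blast
  next
    case Nil
    then have "p \<noteq> []" using w len assms by auto
    then obtain p' y where "p = p' @ [y]" by (metis rev_exhaust)
    then have "w = p' @ (y # u) @ s" using w by simp
    then have "y # u \<in> Fact (Suc i) w" using len by (auto simp: Fact_def sublist_def)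
    then show ?thesis using that by blast
  qed
qed

lemma Fact_Suc_butlast:
  assumes "v \<in> Fact (Suc i) w"
  obtains v' y where "v = v' @ [y]" "v' \<in> Fact i w"
proof -
  obtain v' y where v: "v = v' @ [y]"
    using assms by (cases v rule: rev_cases) (auto simp: Fact_def)
  then have "sublist v' w"
    using assms by (auto simp: Fact_def intro: sublist_order.order.trans)
  then have "v' \<in> Fact i w" using assms v by (auto simp: Fact_def)
  then show ?thesis using that v by blast
qed

section \<open>Standard weights of letters; transfer along equivalence\<close>

lemma standard_weight_append [simp]:
  "standard_weight (v @ w) = standard_weight v + standard_weight w"
  by (simp add: standard_weight_def)

lemma standard_weight_pos: "0 < standard_weight [x :: 'a::{finite,linorder}]"
  by (simp add: standard_weight_def card_gt_0_iff)

lemma standard_weight_letter_le: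
  "standard_weight [x :: 'a::{finite,linorder}] \<le> card (UNIV :: 'a set)"
  by (simp add: standard_weight_def card_mono)

text \<open>Letter weights fill the whole interval from 1 to the alphabet size, so bounding an
  increment by these two numbers is enough to realise it by a letter.\<close>

lemma standard_weight_letter_exists:
  assumes "1 \<le> k" "k \<le> card (UNIV :: 'a::{finite,linorder} set)"
  obtains x :: "'a::{finite,linorder}" where "standard_weight [x] = k"
proof -
  have "standard_weight [sorted_list_of_set (UNIV :: 'a set) ! (k - 1)] = k"
    using assms by (intro standard_weight_nth) auto
  then show ?thesis using that by blast
qed

lemma equivalent_weights_eq:
  assumes "equivalent_weights \<mu> \<nu>" "length v = length w"
  shows "\<mu> v = \<mu> w \<longleftrightarrow> \<nu> v = \<nu> w"
  using assms unfolding equivalent_weights_def by (metis neq_iff)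

lemma equivalent_weights_le:
  assumes "equivalent_weights \<mu> \<nu>" "length v = length w"
  shows "\<mu> v \<le> \<mu> w \<longleftrightarrow> \<nu> v \<le> \<nu> w"
  using assms unfolding equivalent_weights_def by (metis not_less)

section \<open>Weight measures as functions of the multiset of letters\<close>

context
  fixes \<mu> :: "'a::{finite,linorder} list \<Rightarrow> 'm::strict_ordered_monoid_add"
  assumes wm: "weight_measure \<mu>"
begin

lemma weight_append: "\<mu> (v @ w) = \<mu> v + \<mu> w"
  using wm by (auto simp: weight_measure_def)

text \<open>Invariance under rotation suffices: rotate \<open>w\<close> until the first letter of
  \<open>v\<close> leads, strip that letter, and recurse.\<close>

lemma weight_mset_cong: "mset v = mset w \<Longrightarrow> \<mu> v = \<mu> w"
proof (induction v arbitrary: w)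
  case (Cons x v)
  then have "x \<in> set w" by (metis list.set_intros(1) set_mset_mset)
  then obtain w1 w2 where w: "w = w1 @ x # w2" by (metis split_list)
  have "\<mu> w = \<mu> ((x # w2) @ w1)"
    using wm unfolding weight_measure_def w by blast
  also have "\<dots> = \<mu> [x] + \<mu> (w2 @ w1)"
    by (simp flip: weight_append)
  also have "\<mu> (w2 @ w1) = \<mu> v"
    using Cons.IH[of "w2 @ w1"] Cons.prems w by simp
  finally show ?case by (simp flip: weight_append)
qed simp

text \<open>This replaces subtraction: the letters common to both sides are collected in a suffix
  \<open>r\<close>, which total strict monotonicity allows to cancel.\<close>

lemma weight_cancel_eq:
  assumes "\<mu> p = \<mu> q" "mset p = mset (v @ r)" "mset q = mset (w @ r)"
  shows "\<mu> v = \<mu> w"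
proof -
  have "\<mu> (v @ r) = \<mu> (w @ r)"
    using assms weight_mset_cong by metis
  then show ?thesis by (simp add: weight_append add_right_cancel_ord)
qed

lemma weight_mono2:
  assumes "\<mu> p = \<mu> p'" "\<mu> q = \<mu> q'"
  shows "\<mu> (p @ q) = \<mu> (p' @ q')"
  using assms by (simp add: weight_append)

lemma equivalent_imp_gapfree:
  assumes eq: "equivalent_weights \<mu> (standard_weight :: 'a list \<Rightarrow> nat)"
  shows "gapfree \<mu>"
  unfolding gapfree_def no_gap_over_def
proof (intro allI ballI)
  fix w :: "'a list" and i
  assume "i \<in> {1..length w}"
  then obtain j where i: "i = Suc j" and j: "j < length w"
    by (cases i) auto
  note le = equivalent_weights_le[OF eq]
  obtain u where u: "u \<in> Fact j w" "max_weight \<mu> w j = \<mu> u"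
    and u_max: "\<And>v. v \<in> Fact j w \<Longrightarrow> \<mu> v \<le> \<mu> u"
    using max_weight_attained[of j w \<mu>] j by auto
  obtain v where v: "v \<in> Fact i w" "max_weight \<mu> w i = \<mu> v"
    and v_max: "\<And>v'. v' \<in> Fact i w \<Longrightarrow> \<mu> v' \<le> \<mu> v"
    using max_weight_attained[of i w \<mu>] i j by auto
  have len: "length u = j" "length v = Suc j"
    using u v i by (auto simp: Fact_def)
  have lower: "standard_weight u + 1 \<le> standard_weight v"
  proof -
    \<comment> \<open>The new letter may stand on either side of \<open>u\<close>; the multiset
      covers both cases.\<close>
    obtain u' x where u': "u' \<in> Fact i w" "mset u' = mset (u @ [x])"
      using Fact_extend[OF u(1) j] i by (metis add_mset_add_single mset.simps mset_append)
    have "standard_weight u' = standard_weight u + standard_weight [x]"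
      using arg_cong[OF u'(2), of "\<lambda>M. sum_mset (image_mset (\<lambda>a. card {..a}) M)"]
      by (simp add: standard_weight_def sum_mset_sum_list flip: mset_map)
    moreover have "standard_weight u' \<le> standard_weight v"
      using v_max[OF u'(1)] le[of u' v] u'(1) v(1) by (simp add: Fact_def)
    ultimately show ?thesis using standard_weight_pos[of x] by linarith
  qed
  have upper: "standard_weight v \<le> standard_weight u + card (UNIV :: 'a set)"
  proof -
    obtain v' y where v': "v = v' @ [y]" "v' \<in> Fact j w"
      using Fact_Suc_butlast v(1) i by metis
    \<comment> \<open>Both words have length \<open>j\<close>, so maximality of \<open>u\<close> for
      \<mu> passes to the standard weight.\<close>
    have "standard_weight v' \<le> standard_weight u"
      using u_max[OF v'(2)] le[of v' u] v'(2) len by (simp add: Fact_def)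
    then show ?thesis using v'(1) standard_weight_letter_le[of y] by simp
  qed
  have "1 \<le> standard_weight v - standard_weight u"
    "standard_weight v - standard_weight u \<le> card (UNIV :: 'a set)"
    using lower upper by linarith+
  then obtain x :: 'a where "standard_weight [x] = standard_weight v - standard_weight u"
    using standard_weight_letter_exists by blast
  then have "standard_weight v = standard_weight (u @ [x])"
    using lower by simp
  then have "\<mu> v = \<mu> (u @ [x])"
    using equivalent_weights_eq[OF eq, of v "u @ [x]"] len by simp
  then show "\<not> has_gap_at \<mu> w i"
    using u v i by (auto simp: has_gap_at_def weight_append)
qed

section \<open>Consequences of having no gap over cacb\<close>

context
  assumes inj: "injective_weight \<mu>" and ord: "alphabetically_ordered \<mu>"
begin

lemma weight_letter_less: "\<mu> [x] < \<mu> [y] \<longleftrightarrow> x < y"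
proof -
  have "\<mu> [x] < \<mu> [y]" if "x < y" for x y
  proof -
    have "\<mu> [x] \<le> \<mu> [y]" using ord that by (simp add: alphabetically_ordered_def)
    moreover have "\<mu> [x] \<noteq> \<mu> [y]" using inj that by (auto simp: injective_weight_def inj_def)
    ultimately show ?thesis by simp
  qed
  then show ?thesis by (metis less_asym neq_iff)
qed

lemma weight_two_less:
  assumes "x < y"
  shows "\<mu> [x, z] < \<mu> [y, z]"
  using assms weight_append[of "[x]" "[z]"] weight_append[of "[y]" "[z]"]
  by (simp add: add_right_less_cancel_ord weight_letter_less)

lemma no_gap_cacb:
  assumes "a < b" "b < c" "no_gap_over \<mu> [c, a, c, b]"
  obtains x where "\<mu> [a, c] = \<mu> [b, x]" "a < x" "x < c"
proof -
  have swap: "\<mu> [p, q] = \<mu> [q, p]" for p q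
    by (rule weight_mset_cong) simp
  have F2: "Fact 2 [c, a, c, b] = {[c, a], [a, c], [c, b]}"
    by (auto simp: Fact_def sublist_Cons_right prefix_Cons)
  have F3: "Fact 3 [c, a, c, b] = {[c, a, c], [a, c, b]}"
    by (auto simp: Fact_def sublist_Cons_right prefix_Cons)
  have m2: "max_weight \<mu> [c, a, c, b] 2 = \<mu> [c, b]"
    using weight_two_less[OF assms(1), of c] swap[of c a] swap[of c b]
    by (intro max_weight_eqI) (auto simp: F2)
  have m3: "max_weight \<mu> [c, a, c, b] 3 = \<mu> [c, a, c]"
  proof (rule max_weight_eqI)
    \<comment> \<open>The other factor of length 3, rearranged to \<open>[b, a, c]\<close>, differs
      from \<open>[c, a, c]\<close> in one letter only.\<close>
    have "\<mu> [b, a, c] < \<mu> [c, a, c]"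
      using weight_append[of "[b]" "[a, c]"] weight_append[of "[c]" "[a, c]"] assms(2)
      by (simp add: add_right_less_cancel_ord weight_letter_less)
    moreover have "\<mu> [a, c, b] = \<mu> [b, a, c]"
      by (rule weight_mset_cong) simp
    ultimately show "\<mu> v \<le> \<mu> [c, a, c]" if "v \<in> Fact 3 [c, a, c, b]" for v
      using that by (auto simp: F3)
  qed (simp add: F3)
  obtain x where "\<mu> [c, a, c] = \<mu> [c, b] + \<mu> [x]"
    using bspec[OF assms(3)[unfolded no_gap_over_def], of 3] m2 m3
    by (auto simp: has_gap_at_def)
  then have "\<mu> [c, a, c] = \<mu> [c, b, x]"
    using weight_append[of "[c, b]" "[x]"] by simp
  then have x: "\<mu> [a, c] = \<mu> [b, x]"
    by (rule weight_cancel_eq[where r = "[c]"]) simp_all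
  \<comment> \<open>Otherwise \<open>[b, x]\<close> weighs at most \<open>[a, b]\<close>, which is
    lighter than \<open>[a, c]\<close> since b < c.\<close>
  have "a < x"
  proof (rule ccontr)
    assume "\<not> a < x"
    then have "\<mu> [x, b] \<le> \<mu> [a, b]" using weight_two_less[of x a b] by (cases x a rule: linorder_cases) auto
    also have "\<dots> < \<mu> [a, c]"
      using weight_two_less[OF assms(2), of a] swap[of a] by simp
    finally show False using x swap by simp
  qed
  \<comment> \<open>Otherwise \<open>[b, x]\<close> weighs at least \<open>[b, c]\<close>, which is
    heavier than \<open>[a, c]\<close> since a < b.\<close>
  moreover have "x < c"
  proof (rule ccontr)
    assume "\<not> x < c"
    then have "\<mu> [c, b] \<le> \<mu> [x, b]" using weight_two_less[of c x b] by (cases x c rule: linorder_cases) auto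
    moreover have "\<mu> [a, c] < \<mu> [c, b]"
      using weight_two_less[OF assms(1), of c] swap[of b c] by simp
    ultimately show False using x swap[of b x] by simp
  qed
  ultimately show ?thesis using that x by blast
qed

section \<open>Letter weights in arithmetic progression, along the increasing enumeration
  \<open>ls\<close>\<close>

context
  fixes ls :: "'a list"
  assumes nogap: "\<And>a b c. a < b \<Longrightarrow> b < c \<Longrightarrow> no_gap_over \<mu> [c, a, c, b]"
    and ls: "sorted_wrt (<) ls" "set ls = UNIV" "2 \<le> length ls"
begin

lemma nth_less_iff:
  assumes "i < length ls" "j < length ls"
  shows "ls ! i < ls ! j \<longleftrightarrow> i < j"
  using assms ls(1) by (metis less_asym neq_iff sorted_wrt_iff_nth_less)

lemma weight_consecutive:
  assumes "Suc (Suc i) < length ls"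
  shows "\<mu> [ls ! i, ls ! Suc (Suc i)] = \<mu> [ls ! Suc i, ls ! Suc i]"
proof -
  have less: "ls ! i < ls ! Suc i" "ls ! Suc i < ls ! Suc (Suc i)"
    using assms by (auto simp: nth_less_iff)
  obtain x where x: "\<mu> [ls ! i, ls ! Suc (Suc i)] = \<mu> [ls ! Suc i, x]"
    "ls ! i < x" "x < ls ! Suc (Suc i)"
    using no_gap_cacb[OF less nogap[OF less]] by blast
  obtain k where "k < length ls" "x = ls ! k"
    using ls(2) by (metis UNIV_I in_set_conv_nth)
  then have "k = Suc i" using x(2,3) assms by (simp add: nth_less_iff)
  then show ?thesis using x \<open>x = ls ! k\<close> by simp
qed

text \<open>Every step between neighbouring letters equals the first one: the relation for three
  consecutive letters carries this equality from one step to the next.\<close>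

lemma weight_step:
  "Suc i < length ls \<Longrightarrow> \<mu> [ls ! Suc i, ls ! 0] = \<mu> [ls ! i, ls ! 1]"
proof (induction i)
  case 0
  show ?case by (rule weight_mset_cong) simp
next
  case (Suc i)
  have "\<mu> ([ls ! i, ls ! Suc (Suc i)] @ [ls ! Suc i, ls ! 0])
      = \<mu> ([ls ! Suc i, ls ! Suc i] @ [ls ! i, ls ! 1])"
    using Suc weight_consecutive by (intro weight_mono2) auto
  then show ?case
    by (rule weight_cancel_eq[where r = "[ls ! i, ls ! Suc i]"]) simp_all
qed

text \<open>Sums the first \<open>i\<close> steps. The padding makes the number of copies
  \<open>Suc i\<close>, the standard weight of \<open>ls ! i\<close>, so these relations add up
  letter by letter along a word.\<close>

lemma weight_nth:
  "i < length ls \<Longrightarrow>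
    \<mu> (ls ! i # ls ! 1 # replicate (Suc i) (ls ! 0)) = \<mu> (ls ! 0 # ls ! 0 # replicate (Suc i) (ls ! 1))"
proof (induction i)
  case 0
  show ?case by (rule weight_mset_cong) simp
next
  case (Suc i)
  have "\<mu> ([ls ! Suc i, ls ! 0] @ (ls ! i # ls ! 1 # replicate (Suc i) (ls ! 0)))
      = \<mu> ([ls ! i, ls ! 1] @ (ls ! 0 # ls ! 0 # replicate (Suc i) (ls ! 1)))"
    using Suc weight_step by (intro weight_mono2) auto
  then show ?case
    by (rule weight_cancel_eq[where r = "[ls ! i]"]) simp_all
qed

text \<open>
  In a commutative group this says
  \<open>\<mu>(v) = |v| \<sqdot> \<alpha> + (standard_weight v - |v|) \<sqdot> (\<beta> - \<alpha>)\<close>, where \<open>\<alpha>\<close> and \<open>\<beta>\<close> are the weights of the two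
  smallest letters; both sides are moved so that no subtraction occurs.
\<close>

lemma weight_word:
  "\<mu> (v @ replicate (length v) (ls ! 1) @ replicate (standard_weight v) (ls ! 0))
     = \<mu> (replicate (2 * length v) (ls ! 0) @ replicate (standard_weight v) (ls ! 1))"
proof (induction v)
  case Nil
  show ?case by (simp add: standard_weight_def)
next
  case (Cons x v)
  obtain i where i: "i < length ls" "x = ls ! i"
    using ls(2) by (metis UNIV_I in_set_conv_nth)
  have "standard_weight [x] = Suc i"
    using standard_weight_nth[OF ls(1,2), of "Suc i"] i by simp
  then have sw: "standard_weight (x # v) = Suc i + standard_weight v"
    using standard_weight_append[of "[x]" v] by simp
  have "\<mu> ((x # ls ! 1 # replicate (Suc i) (ls ! 0))
        @ (v @ replicate (length v) (ls ! 1) @ replicate (standard_weight v) (ls ! 0)))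
      = \<mu> ((ls ! 0 # ls ! 0 # replicate (Suc i) (ls ! 1))
        @ (replicate (2 * length v) (ls ! 0) @ replicate (standard_weight v) (ls ! 1)))"
    unfolding i(2) by (rule weight_mono2[OF weight_nth[OF i(1)] Cons.IH])
  \<comment> \<open>Nothing is cancelled here; the empty \<open>r\<close> only reorders
    letters.\<close>
  then show ?case
    by (rule weight_cancel_eq[where r = "[]"]) (simp_all add: sw replicate_add)
qed

text \<open>In \<open>weight_word\<close>, the padding and the right-hand side depend on the word
  only through its length and standard weight.\<close>

lemma weight_eq_if_standard_eq:
  assumes "length v = length w" "standard_weight v = standard_weight w"
  shows "\<mu> v = \<mu> w"
proof -
  let ?r = "replicate (length w) (ls ! 1) @ replicate (standard_weight w) (ls ! 0)"
  have "\<mu> (v @ ?r) = \<mu> (w @ ?r)"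
    using weight_word[of v] weight_word[of w] unfolding assms by metis
  then show ?thesis by (rule weight_cancel_eq[OF _ refl refl])
qed

text \<open>An excess \<open>d\<close> of standard weight amounts to \<open>d\<close> replacements
  of the smallest letter by the second smallest, each strictly raising the weight.\<close>

lemma weight_less_if_standard_less:
  assumes "length v = length w" "standard_weight v < standard_weight w"
  shows "\<mu> v < \<mu> w"
proof -
  let ?a = "ls ! 0" and ?b = "ls ! 1"
  obtain d where d: "standard_weight w = standard_weight v + d" "0 < d"
    using assms(2) less_imp_add_positive by metis
  have "\<mu> (w @ replicate (length v) ?b @ replicate (standard_weight v + d) ?a)
     = \<mu> (replicate (2 * length v) ?a @ replicate (standard_weight v + d) ?b)"
    using weight_word[of w] assms(1) d(1) by simp
  also have "\<dots> = \<mu> ((replicate (2 * length v) ?a @ replicate (standard_weight v) ?b) @ replicate d ?b)"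
    by (simp add: replicate_add)
  also have "\<dots> = \<mu> ((v @ replicate (length v) ?b @ replicate (standard_weight v) ?a) @ replicate d ?b)"
    by (rule weight_mono2[OF weight_word[symmetric] refl])
  finally have shift: "\<mu> (w @ replicate d ?a) = \<mu> (v @ replicate d ?b)"
    by (rule weight_cancel_eq[where
        r = "replicate (length v) ?b @ replicate (standard_weight v) ?a"])
      (simp_all add: replicate_add)
  have ab: "\<mu> [?a] < \<mu> [?b]"
    unfolding weight_letter_less using ls(3) nth_less_iff[of 0 1] by linarith
  have "\<mu> (replicate d ?a) < \<mu> (replicate d ?b)"
    using d(2)
  proof (induction d rule: nat_induct_non_zero)
    case 1
    show ?case using ab by simp
  next
    case (Suc n)
    have "\<mu> [?a] + \<mu> (replicate n ?a) < \<mu> [?b] + \<mu> (replicate n ?b)"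
      using ab Suc.IH add_strict_left_mono_ord add_strict_right_mono_ord less_trans by metis
    then show ?case by (simp flip: weight_append)
  qed
  \<comment> \<open>By \<open>shift\<close>, the right-hand side is the weight of \<open>v\<close>
    followed by \<open>d\<close> copies of the heavier letter.\<close>
  then have "\<mu> (v @ replicate d ?a) < \<mu> (w @ replicate d ?a)"
    unfolding shift by (simp add: weight_append add_strict_left_mono_ord)
  then show ?thesis by (simp add: weight_append add_right_less_cancel_ord)
qed

lemma no_gap_imp_equivalent:
  "equivalent_weights \<mu> (standard_weight :: 'a list \<Rightarrow> nat)"
  unfolding equivalent_weights_def
proof (intro allI impI)
  fix n and v w :: "'a list"
  assume "length v = n \<and> length w = n"
  then show "\<mu> v < \<mu> w \<longleftrightarrow> standard_weight v < standard_weight w"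
    using weight_eq_if_standard_eq[of v w]
      weight_less_if_standard_less[of v w] weight_less_if_standard_less[of w v]
    by (cases "standard_weight v" "standard_weight w" rule: linorder_cases) auto
qed

end

end

end

theorem theorem26:
  fixes \<mu> :: "'a::{finite,linorder} list \<Rightarrow> 'm::strict_ordered_monoid_add"
  assumes "weight_measure \<mu>"
    and "non_binary \<mu>"
    and "injective_weight \<mu>"
    and "alphabetically_ordered \<mu>"
  shows "(gapfree \<mu> \<longleftrightarrow> (\<forall>a b c. a < b \<and> b < c \<longrightarrow> no_gap_over \<mu> [c, a, c, b])) \<and>
         ((\<forall>a b c. a < b \<and> b < c \<longrightarrow> no_gap_over \<mu> [c, a, c, b]) \<longleftrightarrow>
            equivalent_weights \<mu> (standard_weight :: 'a list \<Rightarrow> nat))"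
proof -
  let ?ls = "sorted_list_of_set (UNIV :: 'a set)"
  \<comment> \<open>Distinct letter weights need distinct letters, so \<open>ls\<close> has the two
    smallest letters on which the progression is built.\<close>
  have "card (range (\<lambda>x. \<mu> [x])) \<le> card (UNIV :: 'a set)"
    by (rule card_image_le) simp
  then have len: "2 \<le> length ?ls"
    using assms(2) by (simp add: non_binary_def)
  have "equivalent_weights \<mu> (standard_weight :: 'a list \<Rightarrow> nat)"
    if "\<forall>a b c. a < b \<and> b < c \<longrightarrow> no_gap_over \<mu> [c, a, c, b]"
    using no_gap_imp_equivalent[OF assms(1,3,4), of ?ls] that len by simp
  moreover have "gapfree \<mu> \<Longrightarrow> no_gap_over \<mu> [c, a, c, b]" for a b c
    by (simp add: gapfree_def)
  ultimately show ?thesis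
    using equivalent_imp_gapfree[OF assms(1)] by blast
qed

end
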